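(* Let $m = q^k n^2$ be an odd perfect number with special prime $q$, and let $\rho$ be a positive real number with $\rho < \sigma(n^2)/q^k$. Then $$I(q^k) + I(n^2) > l_\rho(q,n), \qquad\text{where}\qquad l_\rho(q,n) = \frac{3q^2 - 4q + 2}{q(q - 1)} - \frac{\rho q}{(q - 1)(2qn^2 - 2n^2 + \rho)} + \frac{\rho}{qn^2}.$$ In particular, there exists a real number $K'$ such that $k < K'$ and $g(K') = l_\rho(q,n)$, and such a $K'$ satisfies $$K' < \log_q 2 + 2\log_q n - \log_q \rho.$$
   Context: For a positive integer $x$, $\sigma(x)=\sum_{d\mid x} d$ is the sum of its positive divisors and $I(x)=\sigma(x)/x$ is its abundancy index. An odd perfect number is an odd positive integer $m$ with $\sigma(m)=2m$. "$q^k n^2$ is an odd perfect number with special prime $q$" means that $m=q^k n^2$ is an odd perfect number, where $k,n$ are positive integers, $q$ is a prime, $q\equiv k\equiv 1 \pmod 4$, and $\gcd(q,n)=1$ (Euler's form). For fixed $q$, the function $g$ of a real variable $x\ge 1$ is $$g(x)=3-\frac{(q^x-1)(q^{x+1}-2q^x+1)}{q^x(q-1)(q^{x+1}-1)};$$ for the given odd perfect number one has $g(k)=I(q^k)+I(n^2)$. *)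

theory Defs
  imports Complex_Main "HOL-Computational_Algebra.Primes" "HOL-Number_Theory.Cong"
begin

text \<open>Sum of divisors and abundancy index. Both are meant for positive arguments only;
  the set of divisors of 0 is infinite, so their value at 0 is the junk value 0.\<close>

definition sigma :: "nat \<Rightarrow> nat" where
  "sigma x = (\<Sum>d | d dvd x. d)"

definition abundancy :: "nat \<Rightarrow> real" where
  "abundancy x = real (sigma x) / real x"

text \<open>Oddness already forces positivity.\<close>

definition odd_perfect :: "nat \<Rightarrow> bool" where
  "odd_perfect m \<longleftrightarrow> odd m \<and> sigma m = 2 * m"

definition odd_perfect_Euler :: "nat \<Rightarrow> nat \<Rightarrow> nat \<Rightarrow> nat \<Rightarrow> bool" where
  "odd_perfect_Euler m q k n \<longleftrightarrow>
     odd_perfect m \<and> m = q ^ k * n\<^sup>2 \<and> k > 0 \<and> n > 0 \<and>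
     prime q \<and> [q = 1] (mod 4) \<and> [k = 1] (mod 4) \<and> coprime q n"

text \<open>The function \<open>g\<close> is only of interest for real \<open>x \<ge> 1\<close>; the formula is simply
  left unrestricted here.\<close>

definition g :: "nat \<Rightarrow> real \<Rightarrow> real" where
  "g q x = 3 -
     ((real q powr x - 1) * (real q powr (x + 1) - 2 * real q powr x + 1)) /
     (real q powr x * (real q - 1) * (real q powr (x + 1) - 1))"

definition l :: "real \<Rightarrow> nat \<Rightarrow> nat \<Rightarrow> real" where
  "l \<rho> q n =
     (3 * (real q)\<^sup>2 - 4 * real q + 2) / (real q * (real q - 1))
     - (\<rho> * real q) / ((real q - 1) * (2 * real q * (real n)\<^sup>2 - 2 * (real n)\<^sup>2 + \<rho>))
     + \<rho> / (real q * (real n)\<^sup>2)"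

end

theory Submission
  imports Defs
begin

text \<open>
  Everything is a statement about one decreasing function. For real \<open>Q \<ge> 1\<close> let
  \<open>A Q = (q Q - 1) / (Q (q - 1))\<close>, which is the abundancy index of \<open>q ^ k\<close> when \<open>Q = q ^ k\<close>.
  Perfection and multiplicativity give \<open>I(q ^ k) I(n\<^sup>2) = 2\<close>, so \<open>I(q ^ k) + I(n\<^sup>2)\<close> is the value at
  \<open>Q = q ^ k\<close> of \<open>h Q = A Q + 2 / A Q\<close>. Moreover \<open>g q x\<close> is \<open>h\<close> at \<open>Q = q powr x\<close>, and
  \<open>l \<rho> q n\<close> is \<open>h\<close> at the point \<open>Q' = ((q - 1) Y + 1) / q\<close>, where \<open>Y = 2 n\<^sup>2 / \<rho>\<close>
  (\<open>g_eq_index_sum\<close>, \<open>l_eq_index_sum\<close>). The point \<open>Q'\<close> is the one at which the extended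
  divisor sum \<open>(q Q - 1) / (q - 1)\<close> takes the value \<open>Y\<close>.

  Since \<open>A\<close> increases and stays below \<open>q / (q - 1) \<le> 4 / 3 < sqrt 2\<close> for \<open>q \<ge> 4\<close>, while
  \<open>t + 2 / t\<close> decreases for \<open>t \<le> sqrt 2\<close>, the function \<open>h\<close> is strictly decreasing
  (\<open>index_sum_strict_antimono\<close>). The hypothesis \<open>\<rho> < \<sigma>(n\<^sup>2) / q ^ k\<close> says
  \<open>\<sigma>(q ^ k) < Y\<close>, because \<open>\<sigma>(q ^ k) \<sigma>(n\<^sup>2) = 2 q ^ k n\<^sup>2\<close>; that is, \<open>q ^ k < Q'\<close>.
  Hence \<open>h (q ^ k) > h Q'\<close>, and \<open>g q K' = l \<rho> q n\<close> has exactly the solution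
  \<open>K' = log q Q' > k\<close> among positive reals. The bound on \<open>K'\<close> is \<open>Q' < Y\<close>, which holds as \<open>Y > 1\<close>.
\<close>

section \<open>The sum of divisors\<close>

lemma sigma_mult_coprime:
  assumes "coprime a b" "a > 0" "b > 0"
  shows "sigma (a * b) = sigma a * sigma b"
proof -
  have inj: "inj_on (\<lambda>(d, e). d * e) ({d. d dvd a} \<times> {e. e dvd b})"
  proof (rule inj_onI, clarify)
    fix d e d' e' assume d: "d dvd a" "d' dvd a" and e: "e dvd b" "e' dvd b"
      and eq: "d * e = d' * e'"
    have "coprime d e'" "coprime d' e"
      using assms(1) d e by (meson coprime_divisors)+
    then have "d dvd d'" "d' dvd d"
      using eq by (metis coprime_dvd_mult_left_iff dvd_triv_left)+
    then have "d = d'" by (rule dvd_antisym)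
    moreover have "d > 0" using d(1) assms(2) by (rule dvd_pos_nat[rotated])
    ultimately show "d = d' \<and> e = e'" using eq by simp
  qed
  have img: "(\<lambda>(d, e). d * e) ` ({d. d dvd a} \<times> {e. e dvd b}) = {c. c dvd a * b}"
  proof (intro equalityI subsetI)
    fix c assume "c \<in> {c. c dvd a * b}"
    then obtain d e where "c = d * e" "d dvd a" "e dvd b"
      using division_decomp[of c a b] by blast
    then show "c \<in> (\<lambda>(d, e). d * e) ` ({d. d dvd a} \<times> {e. e dvd b})"
      by (intro image_eqI[where x = "(d, e)"]) auto
  qed (auto intro: mult_dvd_mono)
  have "sigma (a * b) = (\<Sum>(d, e) \<in> {d. d dvd a} \<times> {e. e dvd b}. d * e)"
    unfolding sigma_def img[symmetric] sum.reindex[OF inj] by (simp add: case_prod_unfold comp_def)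
  also have "\<dots> = sigma a * sigma b"
    unfolding sigma_def by (simp add: sum_product sum.cartesian_product)
  finally show ?thesis .
qed

lemma sigma_prime_power:
  assumes "prime p"
  shows "real (sigma (p ^ k)) = (real p * real p ^ k - 1) / (real p - 1)"
proof -
  have p: "p > 1" using assms by (rule prime_gt_1_nat)
  have "{d. d dvd p ^ k} = (\<lambda>i. p ^ i) ` {..k}"
    using assms by (auto simp: divides_primepow_nat)
  moreover have "inj_on (\<lambda>i. p ^ i) {..k}"
    using p by (auto intro: inj_onI)
  ultimately have "sigma (p ^ k) = (\<Sum>i\<le>k. p ^ i)"
    by (simp add: sigma_def sum.reindex)
  then have "real (sigma (p ^ k)) = (\<Sum>i\<le>k. real p ^ i)" by simp
  also have "\<dots> = (real p * real p ^ k - 1) / (real p - 1)"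
    using p geometric_sum[of "real p" "Suc k"] by (simp add: lessThan_Suc_atMost)
  finally show ?thesis .
qed

section \<open>The abundancy index of a prime power, extended to real exponents\<close>

text \<open>The argument is the power \<open>Q = q powr x\<close> rather than the exponent \<open>x\<close>; this makes all
  functions rational.\<close>

definition power_index :: "real \<Rightarrow> real \<Rightarrow> real" where
  "power_index q Q = (q * Q - 1) / (Q * (q - 1))"

definition index_sum :: "real \<Rightarrow> real \<Rightarrow> real" where
  "index_sum q Q = power_index q Q + 2 / power_index q Q"

text \<open>The difference of the two sides is \<open>(y - x) (2 - x y) / (x y)\<close>.\<close>

lemma plus_two_over_strict_antimono:
  fixes x y :: real
  assumes "0 < x" "x < y" "x * y < 2"
  shows "y + 2 / y < x + 2 / x"
proof -
  have "(x + 2 / x) - (y + 2 / y) = (y - x) * (2 - x * y) / (x * y)"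
    using assms by (simp add: field_simps)
  moreover have "\<dots> > 0" using assms by simp
  ultimately show ?thesis by linarith
qed

lemma power_index_eq:
  assumes "Q > 0" "q > 1"
  shows "power_index q Q = (q - 1 / Q) / (q - 1)"
  using assms by (simp add: power_index_def field_simps)

lemma index_sum_strict_antimono:
  assumes q: "q \<ge> 4" and P: "1 \<le> P" and PQ: "P < Q"
  shows "index_sum q Q < index_sum q P"
  unfolding index_sum_def
proof (rule plus_two_over_strict_antimono)
  have inv: "1 / Q < 1 / P" "1 / P \<le> 1" "1 / Q > 0"
    using P PQ by (auto simp: field_simps)
  show pos: "0 < power_index q P"
  proof -
    have "q - 1 / P > 0" using q inv by linarith
    then show ?thesis using q P by (simp add: power_index_eq)
  qed
  show less: "power_index q P < power_index q Q"
    using q P PQ inv by (simp add: power_index_eq divide_strict_right_mono)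
  have Q43: "power_index q Q \<le> 4 / 3"
  proof -
    have "q - 1 / Q \<le> 4 / 3 * (q - 1)" using q inv by argo
    then show ?thesis using q P PQ by (simp add: power_index_eq pos_divide_le_eq)
  qed
  have "power_index q P * power_index q Q \<le> 4 / 3 * (4 / 3)"
    using pos less Q43 by (intro mult_mono) auto
  then show "power_index q P * power_index q Q < 2" by simp
qed

text \<open>If \<open>a\<close> is the value of the index, then \<open>a + 2 / a = 3 + (a - 1) (a - 2) / a\<close>, and the
  factors of the last term are those in the definition of \<open>g\<close>.\<close>

lemma g_eq_index_sum:
  assumes q: "q > 1" and x: "x \<ge> 0"
  shows "g q x = index_sum (real q) (real q powr x)"
proof -
  define Q where "Q = real q powr x"
  have Q: "Q \<ge> 1" using q x by (simp add: Q_def ge_one_powr_ge_zero)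
  have qQ: "real q * Q > 1"
    using q Q mult_mono[of 1 Q 1 "real q"] less_le_trans[of 1 "real q" "real q * Q"] by simp
  have powr_Suc: "real q powr (x + 1) = real q * Q"
    using q by (simp add: Q_def powr_add)
  have "3 - ((Q - 1) * (r * Q - 2 * Q + 1)) / (Q * (r - 1) * (r * Q - 1))
      = (r * Q - 1) / (Q * (r - 1)) + 2 / ((r * Q - 1) / (Q * (r - 1)))"
    if "Q \<noteq> 0" "r - 1 \<noteq> 0" "r * Q - 1 \<noteq> 0" for r :: real
  proof -
    have "2 / ((r * Q - 1) / (Q * (r - 1))) = 2 * (Q * (r - 1)) / (r * Q - 1)" by simp
    then show ?thesis
      using that by (simp add: divide_simps) (simp add: algebra_simps)
  qed
  then show ?thesis
    using q Q qQ unfolding g_def index_sum_def power_index_def powr_Suc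
    by (simp flip: Q_def)
qed

text \<open>At the given point the index is \<open>q / (q - 1 + 1 / Y)\<close>. This and twice its inverse split
  into the terms of \<open>l\<close>, because \<open>1 / Y = \<rho> / (2 n\<^sup>2)\<close>.\<close>

lemma l_eq_index_sum:
  fixes \<rho> :: real
  assumes q: "q > 1" and n: "n > 0" and \<rho>: "\<rho> > 0"
  defines "Y \<equiv> 2 * (real n)\<^sup>2 / \<rho>"
  shows "l \<rho> q n = index_sum (real q) (((real q - 1) * Y + 1) / real q)"
proof -
  have Y: "Y > 0" using n \<rho> by (simp add: Y_def)
  have n2: "(real n)\<^sup>2 = \<rho> * Y / 2" using \<rho> by (simp add: Y_def)
  have core: "(3 * r\<^sup>2 - 4 * r + 2) / (r * (r - 1))
      - r / ((r - 1) * ((r - 1) * Y + 1)) + 2 / (r * Y)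
      = (r * Y) / ((r - 1) * Y + 1) + 2 * ((r - 1) * Y + 1) / (r * Y)"
    if r: "r > 1" for r :: real
  proof -
    define D where "D = (r - 1) * Y + 1"
    have D: "D > 0" using r Y by (simp add: D_def add_pos_pos)
    have r0: "r \<noteq> 0" "r - 1 \<noteq> 0" using r by auto
    \<comment> \<open>Expanding both summands around their values at \<open>Y = \<infinity>\<close> gives the
      three terms of \<open>l\<close>; the two limits add up to the constant one.\<close>
    have a: "r * Y / D = r / (r - 1) - r / ((r - 1) * D)"
      using r0 D by (simp add: divide_simps) (simp add: D_def algebra_simps)
    have b: "2 * D / (r * Y) = 2 * (r - 1) / r + 2 / (r * Y)"
      using r0 Y by (simp add: divide_simps) (simp add: D_def algebra_simps)
    have c: "(3 * r\<^sup>2 - 4 * r + 2) / (r * (r - 1)) = r / (r - 1) + 2 * (r - 1) / r"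
      using r0 by (simp add: divide_simps) (simp add: algebra_simps power2_eq_square)
    show ?thesis unfolding D_def[symmetric] a b c by simp
  qed
  have "\<rho> * r / ((r - 1) * (2 * r * (real n)\<^sup>2 - 2 * (real n)\<^sup>2 + \<rho>))
      = r / ((r - 1) * ((r - 1) * Y + 1))" for r :: real
  proof -
    have "(r - 1) * (2 * r * (real n)\<^sup>2 - 2 * (real n)\<^sup>2 + \<rho>)
        = \<rho> * ((r - 1) * ((r - 1) * Y + 1))"
      unfolding n2 by (simp add: algebra_simps)
    then show ?thesis using \<rho> by (metis less_irrefl mult_divide_mult_cancel_left)
  qed
  moreover have "\<rho> / (r * (real n)\<^sup>2) = 2 / (r * Y)" for r :: real
    unfolding n2 using \<rho> by simp
  moreover have "power_index r (((r - 1) * Y + 1) / r) = r * Y / ((r - 1) * Y + 1)"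
    if "r > 1" for r :: real
    using that by (simp add: power_index_def)
  ultimately show ?thesis
    using q core[of "real q"] by (simp add: l_def index_sum_def)
qed

section \<open>Odd perfect numbers\<close>

lemma odd_perfect_Euler_sigma_mult:
  assumes "odd_perfect_Euler m q k n"
  shows "real (sigma (q ^ k)) * real (sigma (n\<^sup>2)) = 2 * real q ^ k * (real n)\<^sup>2"
proof -
  have "sigma (q ^ k * n\<^sup>2) = 2 * (q ^ k * n\<^sup>2)"
    and "prime q" "n > 0" "coprime q n"
    using assms by (auto simp: odd_perfect_Euler_def odd_perfect_def)
  then have "sigma (q ^ k) * sigma (n\<^sup>2) = 2 * (q ^ k * n\<^sup>2)"
    using sigma_mult_coprime[of "q ^ k" "n\<^sup>2"] by (simp add: prime_gt_0_nat)
  then have "real (sigma (q ^ k) * sigma (n\<^sup>2)) = real (2 * (q ^ k * n\<^sup>2))" by simp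
  then show ?thesis by simp
qed

theorem corollary2:
  fixes m q k n :: nat and \<rho> :: real
  assumes "odd_perfect_Euler m q k n"
    and "0 < \<rho>"
    and "\<rho> < real (sigma (n\<^sup>2)) / real (q ^ k)"
  shows "abundancy (q ^ k) + abundancy (n\<^sup>2) > l \<rho> q n
    \<and> (\<exists>K'::real. real k < K' \<and> g q K' = l \<rho> q n)
    \<and> (\<forall>K'::real. real k < K' \<and> g q K' = l \<rho> q n \<longrightarrow>
          K' < log (real q) 2 + 2 * log (real q) (real n) - log (real q) \<rho>)"
proof -
  have prime: "prime q" and mod: "[q = 1] (mod 4)" and n: "n > 0"
    using assms(1) by (auto simp: odd_perfect_Euler_def)
  have q1: "q > 1" using prime by (rule prime_gt_1_nat)
  have q4: "real q \<ge> 4"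
  proof -
    have "q mod 4 = 1" using mod by (simp add: cong_def)
    then have "\<not> q < 4" using q1 by auto
    then show ?thesis by simp
  qed
  define Q where "Q = real q ^ k"
  define Y where "Y = 2 * (real n)\<^sup>2 / \<rho>"
  define Q' where "Q' = ((real q - 1) * Y + 1) / real q"
  have Q1: "Q \<ge> 1" using q1 by (simp add: Q_def)
  have Y: "Y > 0" using n assms(2) by (simp add: Y_def)
  have S: "real (sigma (q ^ k)) = (real q * Q - 1) / (real q - 1)"
    using sigma_prime_power[OF prime] by (simp add: Q_def)
  have "real q * Q - 1 \<ge> real q - 1"
    using q1 Q1 by simp
  then have S1: "real (sigma (q ^ k)) \<ge> 1"
    unfolding S using q1 by simp
  have SN: "real (sigma (q ^ k)) * real (sigma (n\<^sup>2)) = 2 * Q * (real n)\<^sup>2"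
    using odd_perfect_Euler_sigma_mult[OF assms(1)] by (simp add: Q_def)
  have SY: "real (sigma (q ^ k)) < Y"
  proof -
    have "\<rho> * Q < real (sigma (n\<^sup>2))"
      using assms(3) Q1 by (simp add: pos_less_divide_eq flip: Q_def)
    then have "real (sigma (q ^ k)) * (\<rho> * Q) < 2 * Q * (real n)\<^sup>2"
      using S1 by (simp flip: SN)
    then have "(real (sigma (q ^ k)) * \<rho>) * Q < (2 * (real n)\<^sup>2) * Q"
      by (simp add: algebra_simps)
    then have "real (sigma (q ^ k)) * \<rho> < 2 * (real n)\<^sup>2"
      using Q1 by simp
    then show ?thesis using assms(2) by (simp add: Y_def field_simps)
  qed
  \<comment> \<open>The increasing map \<open>t \<mapsto> ((q - 1) t + 1) / q\<close> sends \<open>\<sigma>(q ^ k)\<close> to \<open>Q\<close> and \<open>Y\<close> to \<open>Q'\<close>.\<close>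
  have QQ': "Q < Q'"
    using SY q1 unfolding S Q'_def by (simp add: field_simps)
  \<comment> \<open>\<open>Q'\<close> is the weighted mean of \<open>Y\<close> and \<open>1\<close> with weights \<open>(q - 1) / q\<close> and \<open>1 / q\<close>,
    and \<open>1 \<le> \<sigma>(q ^ k) < Y\<close>.\<close>
  have Q'Y: "Q' < Y"
    using S1 SY q1 unfolding Q'_def by (simp add: field_simps)
  have l: "l \<rho> q n = index_sum (real q) Q'"
    using l_eq_index_sum[OF q1 n assms(2)] by (simp add: Q'_def Y_def)
  have index: "abundancy (q ^ k) = power_index (real q) Q"
    unfolding abundancy_def S power_index_def by (simp add: Q_def mult.commute)
  have "abundancy (n\<^sup>2) = 2 / power_index (real q) Q"
  proof -
    have "abundancy (q ^ k) * abundancy (n\<^sup>2) = 2"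
      using SN q1 n by (simp add: abundancy_def Q_def)
    then show ?thesis
      unfolding index
      by (metis mult_zero_left nonzero_mult_div_cancel_left zero_neq_numeral)
  qed
  then have sum: "abundancy (q ^ k) + abundancy (n\<^sup>2) = index_sum (real q) Q"
    by (simp add: index_sum_def index)
  have "l \<rho> q n < abundancy (q ^ k) + abundancy (n\<^sup>2)"
    unfolding l sum by (rule index_sum_strict_antimono[OF q4 Q1 QQ'])
  moreover have "\<exists>K'::real. real k < K' \<and> g q K' = l \<rho> q n"
  proof (intro exI conjI)
    have Q'_powr: "real q powr log (real q) Q' = Q'"
      using q1 Q1 QQ' by simp
    show k: "real k < log (real q) Q'"
    proof -
      have "Q' > 0" using Q1 QQ' by linarith
      moreover have "real q powr real k < Q'"
        using q1 QQ' by (simp add: Q_def powr_realpow)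
      ultimately show ?thesis using q1 by (simp add: less_log_iff)
    qed
    show "g q (log (real q) Q') = l \<rho> q n"
      using g_eq_index_sum[OF q1, of "log (real q) Q'"] k by (simp add: l Q'_powr)
  qed
  moreover have "K' < log (real q) 2 + 2 * log (real q) (real n) - log (real q) \<rho>"
    if K': "real k < K'" "g q K' = l \<rho> q n" for K' :: real
  proof -
    have "index_sum (real q) (real q powr K') = index_sum (real q) Q'"
      using g_eq_index_sum[OF q1, of K'] K' l by simp
    moreover have "real q powr K' \<ge> 1"
      using q1 K' by (simp add: ge_one_powr_ge_zero)
    moreover have "Q' \<ge> 1" using Q1 QQ' by simp
    ultimately have "real q powr K' = Q'"
      using index_sum_strict_antimono[OF q4] by (metis less_irrefl linorder_neqE_linordered_idom)
    then have "real q powr K' < Y" using Q'Y by simp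
    then have "K' < log (real q) Y"
      using q1 Y by (simp add: less_log_iff)
    also have "log (real q) Y = log (real q) 2 + 2 * log (real q) (real n) - log (real q) \<rho>"
      using n assms(2) q1 by (simp add: Y_def log_divide log_mult log_nat_power)
    finally show ?thesis .
  qed
  ultimately show ?thesis by blast
qed

end
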